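(* Let $\Gamma$ be a finite abelian group, $\{F_g\}_{g\in\Gamma}$ a family of complex numbers, $n$ a positive integer, and $\pi\in\mathrm{Hom}(\mathbb{Z}^n,\Gamma)$. For $\eta\in\widehat{\Gamma}$ let $\eta'=\eta\circ\pi\in\widehat{\mathbb{Z}^n}$. If $U$ is a finite subset of $\mathbb{Z}^n$ and $F(z)=\sum_{u\in U}F_{\pi(u)}z^u\in\mathbb{C}[z_1,\ldots,z_n]$, then \[\|F\|_4^4=\frac{1}{|\Gamma|^5}\sum_{\substack{a,b,c,d\in U\\ a+b=c+d}}\ \sum_{\kappa,\lambda,\mu,\nu\in\widehat{\Gamma}}\overline{\kappa'(a)\lambda'(b)}\,\mu'(c)\nu'(d)\,H(\kappa,\lambda,\mu,\nu),\] where $H(\kappa,\lambda,\mu,\nu)=\sum_{\xi\in\widehat{\Gamma}}\widehat{F}_{\xi\kappa}\widehat{F}_{\xi\lambda}\overline{\widehat{F}_{\xi\mu}\widehat{F}_{\xi\nu}}$.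
   Context: $\widehat{\Gamma}$ denotes the group of characters (homomorphisms) from $\Gamma$ to $\mathbb{C}^*$, with pointwise multiplication. For $\eta\in\widehat{\Gamma}$, $\widehat{F}_\eta=\sum_{g\in\Gamma}F_g\eta(g)$. For $u=(u_1,\ldots,u_n)\in\mathbb{Z}^n$, $z^u=z_1^{u_1}\cdots z_n^{u_n}$ (a Laurent monomial). $\|F\|_4=\left(\frac{1}{(2\pi)^n}\int_{[0,2\pi]^n}|F(e^{i\theta_1},\ldots,e^{i\theta_n})|^4d\theta\right)^{1/4}$. *)

theory Defs
  imports "HOL-Analysis.Analysis" "HOL-Algebra.Coset"
begin

definition complex_units :: "complex monoid" where
  "complex_units = \<lparr>carrier = UNIV - {0}, monoid.mult = (*), one = 1\<rparr>"

text \<open>Functions in a carrier-based hom-set are unconstrained off the carrier. Requiring them to be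
  extensional makes each character of \<open>G\<close> occur exactly once, so sums over the carrier
  of the character group are sums over characters.\<close>

definition char_group :: "('a, 'b) monoid_scheme \<Rightarrow> ('a \<Rightarrow> complex) monoid" where
  "char_group G =
    \<lparr>carrier = hom G complex_units \<inter> extensional (carrier G),
     monoid.mult = (\<lambda>\<phi> \<psi>. (\<lambda>g\<in>carrier G. \<phi> g * \<psi> g)),
     one = (\<lambda>g\<in>carrier G. 1)\<rparr>"

definition fourier :: "('a, 'b) monoid_scheme \<Rightarrow> ('a \<Rightarrow> complex) \<Rightarrow> ('a \<Rightarrow> complex) \<Rightarrow> complex" where
  "fourier G F \<eta> = (\<Sum>g\<in>carrier G. F g * \<eta> g)"

definition H_sum :: "('a, 'b) monoid_scheme \<Rightarrow> ('a \<Rightarrow> complex) \<Rightarrow>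
    ('a \<Rightarrow> complex) \<Rightarrow> ('a \<Rightarrow> complex) \<Rightarrow> ('a \<Rightarrow> complex) \<Rightarrow> ('a \<Rightarrow> complex) \<Rightarrow> complex" where
  "H_sum G F \<kappa> l \<mu> \<nu> =
    (\<Sum>\<xi>\<in>carrier (char_group G).
      fourier G F (\<xi> \<otimes>\<^bsub>char_group G\<^esub> \<kappa>) * fourier G F (\<xi> \<otimes>\<^bsub>char_group G\<^esub> l) *
      cnj (fourier G F (\<xi> \<otimes>\<^bsub>char_group G\<^esub> \<mu>) * fourier G F (\<xi> \<otimes>\<^bsub>char_group G\<^esub> \<nu>)))"

definition int_lattice :: "(int ^ 'n) monoid" where
  "int_lattice = \<lparr>carrier = UNIV, monoid.mult = (+), one = 0\<rparr>"

definition laurent_monomial :: "int ^ 'n \<Rightarrow> complex ^ 'n \<Rightarrow> complex" where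
  "laurent_monomial u z = (\<Prod>i\<in>UNIV. (z $ i) powi (u $ i))"

definition torus_L4_norm :: "(complex ^ 'n \<Rightarrow> complex) \<Rightarrow> real" where
  "torus_L4_norm f = root 4 (1 / (2 * pi) ^ CARD('n) *
    (LINT \<theta> : cbox 0 (\<chi> i. 2 * pi) | lborel. cmod (f (\<chi> i. exp (\<i> * of_real (\<theta> $ i)))) ^ 4))"

lemma comm_group_complex_units: "comm_group complex_units"
  by (rule comm_groupI)
     (auto simp: complex_units_def mult.commute intro!: bexI[of _ "inverse x" for x])

lemma comm_group_int_lattice: "comm_group (int_lattice :: (int ^ 'n) monoid)"
proof (rule comm_groupI)
  fix x :: "int ^ 'n"
  show "\<exists>y\<in>carrier int_lattice. y \<otimes>\<^bsub>int_lattice\<^esub> x = \<one>\<^bsub>int_lattice\<^esub>"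
    by (intro bexI[of _ "- x"]) (auto simp: int_lattice_def)
qed (auto simp: int_lattice_def algebra_simps)

lemma comm_group_char_group:
  assumes "comm_group G"
  shows "comm_group (char_group G)"
proof -
  interpret comm_group G by fact
  show ?thesis
  proof (rule comm_groupI)
    fix \<phi> assume "\<phi> \<in> carrier (char_group G)"
    then show "\<exists>\<psi>\<in>carrier (char_group G). \<psi> \<otimes>\<^bsub>char_group G\<^esub> \<phi> = \<one>\<^bsub>char_group G\<^esub>"
      by (intro bexI[of _ "\<lambda>g\<in>carrier G. inverse (\<phi> g)"])
         (auto simp: char_group_def hom_def complex_units_def Pi_def intro!: restrict_ext)
  qed (auto simp: char_group_def hom_def complex_units_def Pi_def extensional_def restrict_def
            mult.assoc mult.commute fun_eq_iff)
qed

lemma char_pullback_in_char_group: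
  assumes "\<pi> \<in> hom int_lattice \<Gamma>" "\<eta> \<in> carrier (char_group \<Gamma>)"
  shows "\<eta> \<circ> \<pi> \<in> carrier (char_group int_lattice)"
  using assms by (auto simp: char_group_def hom_def int_lattice_def extensional_def Pi_def)

end

theory Submission
  imports Defs "HOL-Algebra.Multiplicative_Group"
begin

text \<open>Integrating \<open>F\<^sup>2 * cnj (F\<^sup>2)\<close> over the torus leaves the terms with \<open>a + b = c + d\<close>. For each of
  them, Fourier inversion on \<open>\<Gamma>\<close> turns the four sums over characters into
  \<open>\<xi> (\<pi> a) * \<xi> (\<pi> b) * cnj (\<xi> (\<pi> c) * \<xi> (\<pi> d))\<close> times the coefficients of \<open>F\<close>, and the product of
  values of \<open>\<xi>\<close> is 1. Inversion rests on the existence of separating characters, which are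
  obtained by extending characters from subgroups one generator at a time.\<close>

text \<open>The factors are grouped in two pairs because both uses have two plain and two conjugated
  factors: it collapses the sums over four characters and expands the fourth power of a Laurent
  polynomial.\<close>

lemma sum_product4:
  fixes f :: "'a \<Rightarrow> 'e::semiring_0" and g :: "'b \<Rightarrow> 'e" and h :: "'c \<Rightarrow> 'e" and k :: "'d \<Rightarrow> 'e"
  shows "(\<Sum>a\<in>A. \<Sum>b\<in>B. \<Sum>c\<in>C. \<Sum>d\<in>D. f a * g b * (h c * k d)) =
    sum f A * sum g B * (sum h C * sum k D)"
  by (simp only: sum_distrib_left[symmetric] sum_distrib_right[symmetric])

section \<open>Characters of finite abelian groups\<close>

lemma hom_complex_units_iff:
  "\<phi> \<in> hom G complex_units \<longleftrightarrow>
    (\<forall>x\<in>carrier G. \<phi> x \<noteq> 0) \<and> (\<forall>x\<in>carrier G. \<forall>y\<in>carrier G. \<phi> (x \<otimes>\<^bsub>G\<^esub> y) = \<phi> x * \<phi> y)"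
  by (auto simp: hom_def complex_units_def Pi_def)

lemma carrier_char_group_iff:
  "\<phi> \<in> carrier (char_group G) \<longleftrightarrow> \<phi> \<in> extensional (carrier G) \<and>
    (\<forall>x\<in>carrier G. \<phi> x \<noteq> 0) \<and> (\<forall>x\<in>carrier G. \<forall>y\<in>carrier G. \<phi> (x \<otimes>\<^bsub>G\<^esub> y) = \<phi> x * \<phi> y)"
  by (auto simp: char_group_def hom_complex_units_iff)

lemma char_group_mult:
  "x \<in> carrier G \<Longrightarrow> (\<phi> \<otimes>\<^bsub>char_group G\<^esub> \<psi>) x = \<phi> x * \<psi> x"
  by (simp add: char_group_def)

locale finite_comm_group = comm_group +
  assumes finite_carrier: "finite (carrier G)"
begin

lemma order_pos: "order G > 0"
  using finite_carrier order_gt_0_iff_finite by blast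

section \<open>Extension of characters from subgroups\<close>

text \<open>The value at \<open>\<one>\<close> is a nonzero idempotent of a field. A character of a
  subgroup \<open>H\<close> is a homomorphism on \<open>G\<close> with the carrier replaced by
  \<open>H\<close>, so products and powers remain those of \<open>G\<close>.\<close>

lemma hom_complex_units_one:
  assumes "subgroup H G" "\<phi> \<in> hom (G\<lparr>carrier := H\<rparr>) complex_units"
  shows "\<phi> \<one> = 1"
proof -
  have "\<one> \<in> H" by (rule subgroup.one_closed[OF assms(1)])
  moreover have "\<forall>x\<in>H. \<phi> x \<noteq> 0" "\<forall>x\<in>H. \<forall>y\<in>H. \<phi> (x \<otimes> y) = \<phi> x * \<phi> y"
    using assms(2) by (auto simp: hom_complex_units_iff)
  ultimately have "\<phi> \<one> \<noteq> 0" "\<phi> (\<one> \<otimes> \<one>) = \<phi> \<one> * \<phi> \<one>" by blast+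
  then show ?thesis unfolding l_one[OF one_closed] by (metis mult_cancel_right1)
qed

lemma nat_pow_in_subgroup:
  assumes "subgroup H G" "x \<in> H"
  shows "x [^] (k::nat) \<in> H"
  using assms by (induction k) (auto simp: subgroup.one_closed subgroup.m_closed)

lemma hom_complex_units_pow:
  assumes "subgroup H G" "\<phi> \<in> hom (G\<lparr>carrier := H\<rparr>) complex_units" "x \<in> H"
  shows "\<phi> (x [^] (k::nat)) = \<phi> x ^ k"
proof (induction k)
  case 0
  then show ?case using hom_complex_units_one[OF assms(1,2)] by simp
next
  case (Suc k)
  have "x [^] k \<in> H"
    using assms(1,3) by (rule nat_pow_in_subgroup)
  then have "\<phi> (x [^] k \<otimes> x) = \<phi> (x [^] k) * \<phi> x"
    using assms(2,3) by (simp add: hom_complex_units_iff)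
  then show ?case using Suc by simp
qed

text \<open>The extension sends \<open>h \<otimes> x [^] k\<close> to \<open>\<phi> h * w ^ k\<close>; the condition on \<open>w\<close> makes this well defined.\<close>

lemma extend_hom_one_step:
  assumes H: "subgroup H G" and \<phi>: "\<phi> \<in> hom (G\<lparr>carrier := H\<rparr>) complex_units"
    and x: "x \<in> carrier G" and w0: "w \<noteq> 0"
    and w: "\<And>m::nat. x [^] m \<in> H \<Longrightarrow> \<phi> (x [^] m) = w ^ m"
  obtains H' \<phi>' where "subgroup H' G" "H \<subseteq> H'" "x \<in> H'" "\<phi>' x = w"
    "\<phi>' \<in> hom (G\<lparr>carrier := H'\<rparr>) complex_units" "\<And>h. h \<in> H \<Longrightarrow> \<phi>' h = \<phi> h"
proof -
  have Hc: "h \<in> carrier G" if "h \<in> H" for h by (rule subgroup.mem_carrier[OF H that])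
  have \<phi>0: "\<phi> h \<noteq> 0" if "h \<in> H" for h using \<phi> that by (auto simp: hom_complex_units_iff)
  have \<phi>m: "\<phi> (h \<otimes> h') = \<phi> h * \<phi> h'" if "h \<in> H" "h' \<in> H" for h h'
    using \<phi> that by (auto simp: hom_complex_units_iff)
  have Hm: "h \<otimes> h' \<in> H" if "h \<in> H" "h' \<in> H" for h h' by (rule subgroup.m_closed[OF H that])
  have H1: "\<one> \<in> H" by (rule subgroup.one_closed[OF H])
  have Hi: "inv h \<in> H" if "h \<in> H" for h by (rule subgroup.m_inv_closed[OF H that])
  \<comment> \<open>Natural exponents suffice because \<open>x\<close> has finite order; closure
    under inverses below rests on this.\<close>
  define H' where "H' = {h \<otimes> x [^] (k::nat) |h k. h \<in> H}"
  define \<phi>' where "\<phi>' y = (THE z. \<exists>h (k::nat). h \<in> H \<and> y = h \<otimes> x [^] k \<and> z = \<phi> h * w ^ k)" for y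
  \<comment> \<open>Well-definedness: cancelling \<open>x [^] k\<close> puts
    \<open>x [^] (l - k)\<close> into \<open>H\<close>, where assumption \<open>w\<close> determines
    \<open>\<phi>\<close>. Taking \<open>k \<le> l\<close> loses nothing, as \<open>val\<close> uses
    \<open>le\<close> in both directions.\<close>
  have le: "\<phi> h * w ^ k = \<phi> h' * w ^ l"
    if "h \<in> H" "h' \<in> H" "k \<le> l" "h \<otimes> x [^] k = h' \<otimes> x [^] l" for h h' and k l :: nat
  proof -
    have "h \<otimes> x [^] k = (h' \<otimes> x [^] (l - k)) \<otimes> x [^] k"
      using that x Hc by (simp add: m_assoc nat_pow_mult)
    then have eq: "h = h' \<otimes> x [^] (l - k)"
      using that x Hc right_cancel[of "x [^] k" h "h' \<otimes> x [^] (l - k)"] by simp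
    then have "x [^] (l - k) = inv h' \<otimes> h"
      using that x Hc by (simp add: inv_solve_left)
    then have in_H: "x [^] (l - k) \<in> H" using that Hm Hi by simp
    have "\<phi> h = \<phi> h' * w ^ (l - k)" using eq w[OF in_H] \<phi>m[OF that(2) in_H] by simp
    then have "\<phi> h * w ^ k = \<phi> h' * (w ^ (l - k) * w ^ k)" by simp
    also have "w ^ (l - k) * w ^ k = w ^ l" using that(3) by (simp flip: power_add)
    finally show ?thesis .
  qed
  have val: "\<phi>' (h \<otimes> x [^] k) = \<phi> h * w ^ k" if "h \<in> H" for h and k :: nat
    unfolding \<phi>'_def
  proof (rule the_equality)
    fix z assume "\<exists>h' (l::nat). h' \<in> H \<and> h \<otimes> x [^] k = h' \<otimes> x [^] l \<and> z = \<phi> h' * w ^ l"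
    then show "z = \<phi> h * w ^ k" using le that by (metis nat_le_linear)
  qed (use that in blast)
  have prod: "(h \<otimes> x [^] k) \<otimes> (h' \<otimes> x [^] l) = (h \<otimes> h') \<otimes> x [^] (k + l)"
    if "h \<in> H" "h' \<in> H" for h h' and k l :: nat
    using that Hc x by (simp add: m_ac flip: nat_pow_mult)
  have sub: "subgroup H' G"
  proof (rule subgroupI)
    show "H' \<subseteq> carrier G" using Hc x by (auto simp: H'_def)
    show "H' \<noteq> {}" using H1 by (auto simp: H'_def)
    fix a assume "a \<in> H'"
    then obtain h and k :: nat where a: "a = h \<otimes> x [^] k" "h \<in> H" by (auto simp: H'_def)
    \<comment> \<open>With this choice \<open>k + l\<close> is a multiple of the group order, so
      \<open>x [^] l\<close> is the inverse of \<open>x [^] k\<close>.\<close>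
    define l where "l = k * (order G - 1)"
    have "k + l = order G * k" using order_pos by (simp add: l_def algebra_simps diff_mult_distrib2)
    then have "x [^] (k + l) = \<one>" using x by (simp add: pow_order_eq_1 flip: nat_pow_pow)
    then have "inv h \<otimes> x [^] l \<otimes> a = \<one>"
      using prod[OF Hi[OF a(2)] a(2), of l k] a Hc by (simp add: add.commute)
    then have "inv a = inv h \<otimes> x [^] l"
      using a Hc x Hi by (intro inv_equality) auto
    then show "inv a \<in> H'" using Hi a(2) by (auto simp: H'_def)
  next
    fix a b assume "a \<in> H'" "b \<in> H'"
    then show "a \<otimes> b \<in> H'" using prod Hm by (fastforce simp: H'_def)
  qed
  have *: "h \<in> H'" "\<phi>' h = \<phi> h" if "h \<in> H" for h
    using val[OF that, of 0] Hc[OF that] that by (force simp: H'_def intro: exI[of _ "0::nat"])+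
  have x': "x \<in> H'" "\<phi>' x = w"
    using val[OF H1, of 1] x H1 hom_complex_units_one[OF H \<phi>]
    by (force simp: H'_def intro: exI[of _ "1::nat"])+
  have "\<phi>' \<in> hom (G\<lparr>carrier := H'\<rparr>) complex_units"
    unfolding hom_complex_units_iff
  proof (intro conjI ballI; simp)
    show "\<phi>' a \<noteq> 0" if "a \<in> H'" for a
      using that val \<phi>0 w0 by (auto simp: H'_def)
    fix a b assume "a \<in> H'" "b \<in> H'"
    then obtain h h' and k l :: nat where "a = h \<otimes> x [^] k" "h \<in> H" "b = h' \<otimes> x [^] l" "h' \<in> H"
      by (auto simp: H'_def)
    then show "\<phi>' (a \<otimes> b) = \<phi>' a * \<phi>' b"
      by (simp add: prod val Hm \<phi>m power_add)
  qed
  with sub * x' show thesis by (intro that[of H' \<phi>']) auto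
qed

text \<open>Here \<open>r\<close> is the order of the coset of \<open>x\<close> modulo
  \<open>H\<close>. If \<open>r\<close> did not divide such an \<open>m\<close>, division with
  remainder would give the smaller positive exponent \<open>m mod r\<close>.\<close>

lemma least_power_in_subgroup:
  assumes H: "subgroup H G" and x: "x \<in> carrier G"
  obtains r :: nat where "r > 0" "x [^] r \<in> H" "\<And>m. x [^] m \<in> H \<longleftrightarrow> r dvd m"
proof -
  define r where "r = (LEAST r::nat. r > 0 \<and> x [^] r \<in> H)"
  \<comment> \<open>The group order is one admissible exponent, so the minimum exists.\<close>
  have "order G > 0 \<and> x [^] order G \<in> H"
    using order_pos pow_order_eq_1[OF x] subgroup.one_closed[OF H] by simp
  then have r: "r > 0" "x [^] r \<in> H"
    unfolding r_def by (metis (mono_tags, lifting) LeastI)+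
  have pw: "x [^] (r * q) \<in> H" for q :: nat
    using nat_pow_in_subgroup[OF H r(2), of q] x by (simp add: nat_pow_pow)
  have "r dvd m" if "x [^] m \<in> H" for m
  proof (rule ccontr)
    assume "\<not> r dvd m"
    then have "m mod r > 0" "m mod r < r" using r by (auto simp: dvd_eq_mod_eq_0)
    moreover have "x [^] m = x [^] (r * (m div r)) \<otimes> x [^] (m mod r)"
      using x by (simp add: nat_pow_mult)
    then have "x [^] (m mod r) = inv (x [^] (r * (m div r))) \<otimes> x [^] m"
      using x by (metis inv_solve_left nat_pow_closed)
    then have "x [^] (m mod r) \<in> H"
      using H pw that by (simp add: subgroup.m_closed subgroup.m_inv_closed)
    ultimately show False using not_less_Least r_def by blast
  qed
  with r pw show thesis by (intro that[of r]) (auto elim: dvdE)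
qed

text \<open>Since every nonzero complex number has an \<open>r\<close>-th root, a character extends
  past any element outside \<open>H\<close>; the number of missing elements drops, so finitely many
  such steps reach \<open>G\<close>.\<close>

lemma extend_hom:
  assumes "subgroup H G" "\<phi> \<in> hom (G\<lparr>carrier := H\<rparr>) complex_units"
  shows "\<exists>\<psi>\<in>hom G complex_units. \<forall>h\<in>H. \<psi> h = \<phi> h"
  using assms
proof (induction "card (carrier G - H)" arbitrary: H \<phi> rule: less_induct)
  case less
  show ?case
  proof (cases "H = carrier G")
    case True
    then show ?thesis using less.prems by auto
  next
    case False
    have HG: "H \<subseteq> carrier G" using less.prems(1) subgroup.subset by blast
    with False obtain x where x: "x \<in> carrier G" "x \<notin> H" by blast
    obtain r :: nat where r: "r > 0" "x [^] r \<in> H" "\<And>m. x [^] m \<in> H \<longleftrightarrow> r dvd m"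
      using least_power_in_subgroup[OF less.prems(1) x(1)] by metis
    have nz: "\<phi> (x [^] r) \<noteq> 0" using less.prems(2) r(2) by (auto simp: hom_complex_units_iff)
    \<comment> \<open>An \<open>r\<close>-th root of \<open>\<phi> (x [^] r)\<close>. Every power of
      \<open>x\<close> lying in \<open>H\<close> is a power of \<open>x [^] r\<close>, so this one
      equation yields the condition of \<open>extend_hom_one_step\<close>.\<close>
    define w where "w = exp (Ln (\<phi> (x [^] r)) / of_nat r)"
    have wr: "w ^ r = \<phi> (x [^] r)"
      using r(1) nz by (simp add: w_def flip: exp_of_nat_mult)
    have "\<phi> (x [^] m) = w ^ m" if m: "x [^] m \<in> H" for m :: nat
    proof -
      obtain q where q: "m = r * q" using m r(3) by (auto elim: dvdE)
      have "\<phi> (x [^] m) = \<phi> (x [^] r) ^ q"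
        using hom_complex_units_pow[OF less.prems r(2), of q] x by (simp add: q nat_pow_pow)
      then show ?thesis by (simp add: q power_mult wr)
    qed
    then obtain H' \<phi>' where H': "subgroup H' G" "H \<subseteq> H'" "x \<in> H'"
      "\<phi>' \<in> hom (G\<lparr>carrier := H'\<rparr>) complex_units" "\<And>h. h \<in> H \<Longrightarrow> \<phi>' h = \<phi> h"
      using extend_hom_one_step[OF less.prems x(1), of w] by (metis exp_not_eq_zero w_def)
    have "card (carrier G - H') < card (carrier G - H)"
      using x H' finite_carrier by (intro psubset_card_mono) auto
    from less.hyps[OF this H'(1,4)] show ?thesis using H' by (metis subset_iff)
  qed
qed

text \<open>The trivial character of \<open>{\<one>}\<close> is first extended by sending
  \<open>x\<close> to a primitive root of unity whose order is that of \<open>x\<close>, then to all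
  of \<open>G\<close>.\<close>

lemma separating_character:
  assumes x: "x \<in> carrier G" "x \<noteq> \<one>"
  obtains \<phi> where "\<phi> \<in> carrier (char_group G)" "\<phi> x \<noteq> 1"
proof -
  have T: "subgroup {\<one>} G" by (rule triv_subgroup)
  have t: "(\<lambda>_. 1) \<in> hom (G\<lparr>carrier := {\<one>}\<rparr>) complex_units" by (simp add: hom_complex_units_iff)
  obtain r :: nat where r: "r > 0" "\<And>m. x [^] m \<in> {\<one>} \<longleftrightarrow> r dvd m"
    using least_power_in_subgroup[OF T x(1)] by metis
  have "r \<noteq> 1" using r(2)[of 1] x by auto
  \<comment> \<open>As \<open>H\<close> is trivial, \<open>r\<close> is the order of
    \<open>x\<close>. If \<open>w\<close> were 1, the angle would be a multiple of
    \<open>2 * pi\<close>, forcing \<open>r\<close> to divide 1.\<close>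
  define w where "w = cis (2 * pi / r)"
  have wr: "w ^ r = 1" using r by (simp add: w_def Complex.DeMoivre)
  have w1: "w \<noteq> 1"
  proof
    assume "w = 1"
    then have "cos (2 * pi / r) = 1" by (simp add: w_def complex_eq_iff)
    then obtain k :: int where "2 * pi / r = of_int k * 2 * pi" by (auto simp: cos_one_2pi_int)
    then have "1 = of_int k * real r" using r(1) by (simp add: field_simps)
    then have "1 = k * int r" by (metis of_int_1 of_int_eq_iff of_int_mult of_int_of_nat_eq)
    then show False using \<open>r \<noteq> 1\<close> r(1) by (metis dvd_triv_right int_dvd_int_iff nat_dvd_1_iff_1 of_nat_1)
  qed
  have "1 = w ^ m" if "x [^] m \<in> {\<one>}" for m :: nat
    using that r(2) wr by (auto elim!: dvdE simp: power_mult)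
  then obtain H' \<phi>' where H': "subgroup H' G" "x \<in> H'" "\<phi>' x = w"
      "\<phi>' \<in> hom (G\<lparr>carrier := H'\<rparr>) complex_units"
    using extend_hom_one_step[OF T t x(1), of w] by (metis cis_neq_zero w_def)
  then obtain \<psi> where "\<psi> \<in> hom G complex_units" "\<psi> x = w" using extend_hom by metis
  \<comment> \<open>Restriction makes \<open>\<psi>\<close> extensional, as membership in the
    character group demands.\<close>
  then show thesis using w1 x
    by (intro that[of "restrict \<psi> (carrier G)"])
       (auto simp: carrier_char_group_iff hom_complex_units_iff)
qed

section \<open>Values of characters and orthogonality relations\<close>

lemma char_mult:
  "\<phi> \<in> carrier (char_group G) \<Longrightarrow> x \<in> carrier G \<Longrightarrow> y \<in> carrier G \<Longrightarrow> \<phi> (x \<otimes> y) = \<phi> x * \<phi> y"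
  by (simp add: carrier_char_group_iff)

lemma char_one: "\<phi> \<in> carrier (char_group G) \<Longrightarrow> \<phi> \<one> = 1"
  using hom_complex_units_one[OF subgroup_self, of \<phi>] by (simp add: char_group_def)

text \<open>Values of characters are roots of unity, by Lagrange; both their modulus and the
  finiteness of the character group are derived from this.\<close>

lemma char_pow_order:
  assumes "\<phi> \<in> carrier (char_group G)" "x \<in> carrier G"
  shows "\<phi> x ^ order G = 1"
  using hom_complex_units_pow[OF subgroup_self, of \<phi> x "order G"] assms(1) char_one[OF assms(1)]
    pow_order_eq_1[OF assms(2)] assms(2)
  by (auto simp: char_group_def)

lemma norm_char:
  assumes "\<phi> \<in> carrier (char_group G)" "x \<in> carrier G"
  shows "cmod (\<phi> x) = 1"
proof -
  have "cmod (\<phi> x) ^ order G = 1" using char_pow_order[OF assms] by (simp flip: norm_power)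
  then show ?thesis using order_pos by (intro power_eq_imp_eq_base[of _ "order G" 1]) auto
qed

text \<open>Both sides are multiplicative inverses of \<open>\<phi> x\<close>, the left one because
  \<open>\<phi> x\<close> has modulus 1.\<close>

lemma cnj_char:
  assumes "\<phi> \<in> carrier (char_group G)" "x \<in> carrier G"
  shows "cnj (\<phi> x) = \<phi> (inv x)"
proof -
  have "\<phi> x * \<phi> (inv x) = 1"
    using assms(2) char_one[OF assms(1)] char_mult[OF assms(1,2), of "inv x"] by simp
  moreover have "\<phi> x * cnj (\<phi> x) = 1"
    using norm_char[OF assms] by (simp add: complex_norm_square[symmetric])
  moreover have "\<phi> x \<noteq> 0" using assms by (simp add: carrier_char_group_iff)
  ultimately show ?thesis by (metis mult_left_cancel)
qed

text \<open>Being extensional, characters lie in the finite space of functions from \<open>G\<close>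
  to the roots of unity of exponent \<open>order G\<close>.\<close>

lemma finite_char_group: "finite (carrier (char_group G))"
proof (rule finite_subset)
  have "finite {z::complex. z ^ order G = 1}"
    using finite_roots_unity[of "order G"] order_pos by simp
  then show "finite (carrier G \<rightarrow>\<^sub>E {z::complex. z ^ order G = 1})"
    using finite_carrier by (intro finite_PiE)
  show "carrier (char_group G) \<subseteq> carrier G \<rightarrow>\<^sub>E {z. z ^ order G = 1}"
    using char_pow_order by (auto simp: PiE_def carrier_char_group_iff)
qed

text \<open>Translating the sum by a character \<open>\<psi>\<close> permutes its terms and
  multiplies it by \<open>\<psi> x\<close>, which can be chosen different from 1.\<close>

lemma sum_over_characters_eq_0:
  assumes "x \<in> carrier G" "x \<noteq> \<one>"
  shows "(\<Sum>\<phi>\<in>carrier (char_group G). \<phi> x) = 0"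
proof -
  interpret D: comm_group "char_group G" by (rule comm_group_char_group) (rule comm_group_axioms)
  obtain \<psi> where \<psi>: "\<psi> \<in> carrier (char_group G)" "\<psi> x \<noteq> 1"
    using separating_character[OF assms] .
  have "(\<Sum>\<phi>\<in>carrier (char_group G). \<phi> x) = (\<Sum>\<phi>\<in>carrier (char_group G). (\<psi> \<otimes>\<^bsub>char_group G\<^esub> \<phi>) x)"
    using \<psi>(1) finite_char_group
    by (intro sum.reindex_bij_betw[symmetric] bij_betwI[where g = "\<lambda>\<phi>. inv\<^bsub>char_group G\<^esub> \<psi> \<otimes>\<^bsub>char_group G\<^esub> \<phi>"])
       (auto simp flip: D.m_assoc)
  also have "\<dots> = \<psi> x * (\<Sum>\<phi>\<in>carrier (char_group G). \<phi> x)"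
    by (simp add: char_group_mult assms sum_distrib_left)
  finally show ?thesis using \<psi>(2) by auto
qed

text \<open>The same argument with group and character group exchanged: translation by
  \<open>x\<close> multiplies the sum by \<open>\<phi> x\<close>.\<close>

lemma sum_character_eq_0:
  assumes "\<phi> \<in> carrier (char_group G)" "x \<in> carrier G" "\<phi> x \<noteq> 1"
  shows "(\<Sum>y\<in>carrier G. \<phi> y) = 0"
proof -
  have "(\<Sum>y\<in>carrier G. \<phi> y) = (\<Sum>y\<in>carrier G. \<phi> (x \<otimes> y))"
    using assms(2)
    by (intro sum.reindex_bij_betw[symmetric] bij_betwI[where g = "\<lambda>y. inv x \<otimes> y"])
       (auto simp flip: m_assoc)
  also have "\<dots> = \<phi> x * (\<Sum>y\<in>carrier G. \<phi> y)"
    using assms by (simp add: carrier_char_group_iff sum_distrib_left)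
  finally show ?thesis using assms(3) by auto
qed

text \<open>Double counting of the sum of all \<open>\<phi> x\<close>: summing over characters first
  leaves only \<open>x = \<one>\<close>, summing over the group first leaves only the trivial
  character.\<close>

lemma card_char_group: "card (carrier (char_group G)) = order G"
proof -
  interpret D: comm_group "char_group G" by (rule comm_group_char_group) (rule comm_group_axioms)
  have 1: "(\<Sum>y\<in>carrier G. \<phi> y) = (if \<phi> = \<one>\<^bsub>char_group G\<^esub> then of_nat (order G) else 0)"
    if \<phi>: "\<phi> \<in> carrier (char_group G)" for \<phi>
  proof (cases "\<phi> = \<one>\<^bsub>char_group G\<^esub>")
    case True
    then show ?thesis by (simp add: char_group_def order_def)
  next
    case False
    \<comment> \<open>Both characters take the same default value off the carrier, so they must
      differ on it.\<close>
    then obtain x where "x \<in> carrier G" "\<phi> x \<noteq> 1"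
      using \<phi> by (auto simp: char_group_def fun_eq_iff extensional_def split: if_splits)
    then show ?thesis using False sum_character_eq_0[OF \<phi>] by auto
  qed
  have "of_nat (card (carrier (char_group G))) = (\<Sum>x\<in>carrier G. if x = \<one> then of_nat (card (carrier (char_group G))) else (0::complex))"
    using finite_carrier by simp
  also have "\<dots> = (\<Sum>x\<in>carrier G. \<Sum>\<phi>\<in>carrier (char_group G). \<phi> x)"
    by (intro sum.cong) (auto simp: sum_over_characters_eq_0 char_one)
  also have "\<dots> = (\<Sum>\<phi>\<in>carrier (char_group G). \<Sum>x\<in>carrier G. \<phi> x)" by (rule sum.swap)
  also have "\<dots> = of_nat (order G)" using finite_char_group by (simp add: 1)
  finally show ?thesis by (simp only: of_nat_eq_iff)
qed

text \<open>The summand is \<open>\<phi> (inv x \<otimes> y)\<close>, which reduces the claim to the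
  sum of all characters at a single element.\<close>

lemma character_orthogonality:
  assumes "x \<in> carrier G" "y \<in> carrier G"
  shows "(\<Sum>\<phi>\<in>carrier (char_group G). cnj (\<phi> x) * \<phi> y) = (if y = x then of_nat (order G) else 0)"
proof -
  have "(\<Sum>\<phi>\<in>carrier (char_group G). cnj (\<phi> x) * \<phi> y) = (\<Sum>\<phi>\<in>carrier (char_group G). \<phi> (inv x \<otimes> y))"
    using assms by (intro sum.cong) (auto simp: cnj_char carrier_char_group_iff)
  also have "\<dots> = (if y = x then of_nat (order G) else 0)"
  proof (cases "y = x")
    case True
    then show ?thesis using assms by (simp add: char_one card_char_group)
  next
    case False
    then have "inv x \<otimes> y \<noteq> \<one>" using assms by (metis inv_solve_left' one_closed r_one)
    then show ?thesis using False assms by (simp add: sum_over_characters_eq_0)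
  qed
  finally show ?thesis .
qed

section \<open>Fourier inversion and the sum over four characters\<close>

text \<open>The transform of \<open>F\<close> at the product of \<open>\<xi>\<close> and
  \<open>\<kappa>\<close> is the transform of \<open>F\<close> times \<open>\<xi>\<close> at
  \<open>\<kappa>\<close>, so this is Fourier inversion for the twisted function.\<close>

lemma shifted_fourier_inversion:
  assumes x: "x \<in> carrier G"
  shows "(\<Sum>\<kappa>\<in>carrier (char_group G). cnj (\<kappa> x) * fourier G F (\<xi> \<otimes>\<^bsub>char_group G\<^esub> \<kappa>)) =
    of_nat (order G) * (F x * \<xi> x)"
proof -
  have "(\<Sum>\<kappa>\<in>carrier (char_group G). cnj (\<kappa> x) * fourier G F (\<xi> \<otimes>\<^bsub>char_group G\<^esub> \<kappa>)) =
      (\<Sum>\<kappa>\<in>carrier (char_group G). \<Sum>y\<in>carrier G. F y * \<xi> y * (cnj (\<kappa> x) * \<kappa> y))"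
    by (simp add: fourier_def char_group_mult sum_distrib_left mult_ac)
  also have "\<dots> = (\<Sum>y\<in>carrier G. F y * \<xi> y * (\<Sum>\<kappa>\<in>carrier (char_group G). cnj (\<kappa> x) * \<kappa> y))"
    by (subst sum.swap) (simp add: sum_distrib_left)
  also have "\<dots> = (\<Sum>y\<in>carrier G. if y = x then F y * \<xi> y * of_nat (order G) else 0)"
    by (intro sum.cong) (auto simp: character_orthogonality x)
  also have "\<dots> = of_nat (order G) * (F x * \<xi> x)" using finite_carrier x by simp
  finally show ?thesis .
qed

text \<open>For fixed \<open>\<xi>\<close> the four sums decouple and inversion gives one factor
  \<open>order G\<close> each; the fifth comes from the sum over \<open>\<xi>\<close>, whose terms
  no longer depend on \<open>\<xi>\<close>.\<close>

lemma sum_H_sum: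
  assumes abcd: "a \<in> carrier G" "b \<in> carrier G" "c \<in> carrier G" "d \<in> carrier G"
    and eq: "a \<otimes> b = c \<otimes> d"
  defines "X \<equiv> carrier (char_group G)"
  shows "(\<Sum>\<kappa>\<in>X. \<Sum>l\<in>X. \<Sum>\<mu>\<in>X. \<Sum>\<nu>\<in>X. cnj (\<kappa> a * l b) * \<mu> c * \<nu> d * H_sum G F \<kappa> l \<mu> \<nu>) =
    of_nat (order G) ^ 5 * (F a * F b * cnj (F c * F d))"
proof -
  define f where "f x \<xi> \<kappa> = cnj (\<kappa> x) * fourier G F (\<xi> \<otimes>\<^bsub>char_group G\<^esub> \<kappa>)" for x \<xi> \<kappa>
  define N :: complex where "N = of_nat (order G)"
  have f: "(\<Sum>\<kappa>\<in>X. f x \<xi> \<kappa>) = N * (F x * \<xi> x)" if "x \<in> carrier G" for x \<xi>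
    using shifted_fourier_inversion[OF that] by (simp add: f_def X_def N_def)
  \<comment> \<open>By \<open>eq\<close> the product is the squared modulus of
    \<open>\<xi> c * \<xi> d\<close>.\<close>
  have \<xi>: "\<xi> a * \<xi> b * cnj (\<xi> c * \<xi> d) = 1" if "\<xi> \<in> X" for \<xi>
  proof -
    have e: "\<xi> a * \<xi> b = \<xi> c * \<xi> d"
      using that abcd eq by (metis X_def char_mult)
    have "cmod (\<xi> c * \<xi> d) = 1" using that abcd by (simp add: X_def norm_char norm_mult)
    then show ?thesis unfolding e by (simp only: complex_norm_square[symmetric]) simp
  qed
  have "(\<Sum>\<kappa>\<in>X. \<Sum>l\<in>X. \<Sum>\<mu>\<in>X. \<Sum>\<nu>\<in>X. cnj (\<kappa> a * l b) * \<mu> c * \<nu> d * H_sum G F \<kappa> l \<mu> \<nu>) =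
      (\<Sum>\<kappa>\<in>X. \<Sum>l\<in>X. \<Sum>\<mu>\<in>X. \<Sum>\<nu>\<in>X. \<Sum>\<xi>\<in>X. f a \<xi> \<kappa> * f b \<xi> l * (cnj (f c \<xi> \<mu>) * cnj (f d \<xi> \<nu>)))"
    by (simp add: H_sum_def f_def sum_distrib_left X_def mult_ac)
  \<comment> \<open>The sum over \<open>\<xi>\<close> is moved outwards past one summation at a
    time.\<close>
  also have "\<dots> = (\<Sum>\<kappa>\<in>X. \<Sum>l\<in>X. \<Sum>\<mu>\<in>X. \<Sum>\<xi>\<in>X. \<Sum>\<nu>\<in>X. f a \<xi> \<kappa> * f b \<xi> l * (cnj (f c \<xi> \<mu>) * cnj (f d \<xi> \<nu>)))"
    by (rule sum.cong[OF refl], rule sum.cong[OF refl], rule sum.cong[OF refl], rule sum.swap)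
  also have "\<dots> = (\<Sum>\<kappa>\<in>X. \<Sum>l\<in>X. \<Sum>\<xi>\<in>X. \<Sum>\<mu>\<in>X. \<Sum>\<nu>\<in>X. f a \<xi> \<kappa> * f b \<xi> l * (cnj (f c \<xi> \<mu>) * cnj (f d \<xi> \<nu>)))"
    by (rule sum.cong[OF refl], rule sum.cong[OF refl], rule sum.swap)
  also have "\<dots> = (\<Sum>\<kappa>\<in>X. \<Sum>\<xi>\<in>X. \<Sum>l\<in>X. \<Sum>\<mu>\<in>X. \<Sum>\<nu>\<in>X. f a \<xi> \<kappa> * f b \<xi> l * (cnj (f c \<xi> \<mu>) * cnj (f d \<xi> \<nu>)))"
    by (rule sum.cong[OF refl], rule sum.swap)
  also have "\<dots> = (\<Sum>\<xi>\<in>X. \<Sum>\<kappa>\<in>X. \<Sum>l\<in>X. \<Sum>\<mu>\<in>X. \<Sum>\<nu>\<in>X. f a \<xi> \<kappa> * f b \<xi> l * (cnj (f c \<xi> \<mu>) * cnj (f d \<xi> \<nu>)))"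
    by (rule sum.swap)
  also have "\<dots> = (\<Sum>\<xi>\<in>X. (\<Sum>\<kappa>\<in>X. f a \<xi> \<kappa>) * (\<Sum>l\<in>X. f b \<xi> l) *
      cnj ((\<Sum>\<mu>\<in>X. f c \<xi> \<mu>) * (\<Sum>\<nu>\<in>X. f d \<xi> \<nu>)))"
    by (simp only: sum_product4 cnj_sum complex_cnj_mult)
  also have "\<dots> = (\<Sum>\<xi>\<in>X. N ^ 4 * (F a * F b * cnj (F c * F d)) * (\<xi> a * \<xi> b * cnj (\<xi> c * \<xi> d)))"
    using abcd by (intro sum.cong) (auto simp: f N_def power_numeral_reduce)
  also have "\<dots> = N ^ 5 * (F a * F b * cnj (F c * F d))"
    by (simp only: \<xi> cong: sum.cong) (simp add: X_def card_char_group N_def power_numeral_reduce)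
  finally show ?thesis by (simp add: N_def)
qed

end

section \<open>The fourth moment of a Laurent polynomial on the torus\<close>

text \<open>For \<open>k \<noteq> 0\<close> the antiderivative has period \<open>2 * pi\<close>, so
  its boundary values cancel.\<close>

lemma integral_exp_int:
  "(LINT t:{0..2*pi}|lborel. exp (\<i> * of_int k * of_real t)) = (if k = 0 then 2 * pi else 0 :: complex)"
proof -
  let ?f = "\<lambda>t::real. exp (\<i> * of_int k * of_real t)"
  have int: "set_integrable lborel {0..2*pi} ?f"
    by (intro borel_integrable_atLeastAtMost') (auto intro!: continuous_intros)
  show ?thesis
  proof (cases "k = 0")
    case True
    then show ?thesis by (simp add: set_lebesgue_integral_def scaleR_conv_of_real)
  next
    case False
    let ?g = "\<lambda>t::real. exp (\<i> * of_int k * of_real t) / (\<i> * of_int k)"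
    have "(?f has_integral ?g (2*pi) - ?g 0) {0..2*pi}"
      using False by (intro fundamental_theorem_of_calculus)
        (auto intro!: derivative_eq_intros has_vector_derivative_real_field simp: field_simps)
    moreover have "exp (\<i> * of_int k * of_real (2*pi)) = 1"
      using exp_integer_2pi[of "of_int k"] by (simp add: mult_ac)
    ultimately have "(?f has_integral 0) {0..2*pi}" by simp
    then show ?thesis using False
      by (simp add: set_borel_integral_eq_integral(2)[OF int] integral_unique)
  qed
qed

lemma set_integrable_continuous_cbox:
  fixes f :: "'a::euclidean_space \<Rightarrow> 'b::{banach, second_countable_topology}"
  assumes "continuous_on (cbox a b) f"
  shows "set_integrable lborel (cbox a b) f"
  unfolding set_integrable_def using assms by (intro borel_integrable_compact) auto

text \<open>Translates between basis vectors, which index the product measure behind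
  \<open>lborel\<close>, and coordinates, which index the integrand.\<close>

lemma prod_Basis_vec: "(\<Prod>b\<in>(Basis :: (real^'n) set). f b) = (\<Prod>i\<in>UNIV. f (axis i 1))"
proof -
  have B: "(Basis :: (real^'n) set) = (\<lambda>i. axis i 1) ` UNIV" by (auto simp: Basis_vec_def)
  show ?thesis unfolding B by (subst prod.reindex) (auto simp: inj_on_def axis_eq_axis)
qed

text \<open>Fubini for functions with separated variables, via \<open>lborel\<close> as the image of
  a product measure.\<close>

lemma integral_prod_components:
  fixes f :: "'n::finite \<Rightarrow> real \<Rightarrow> complex"
  assumes [measurable]: "\<And>i. integrable lborel (f i)"
  shows "(\<integral>\<theta>. (\<Prod>i\<in>UNIV. f i (\<theta> $ i)) \<partial>(lborel :: (real^'n) measure)) = (\<Prod>i\<in>UNIV. \<integral>t. f i t \<partial>lborel)"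
proof -
  interpret product_sigma_finite "\<lambda>_::real^'n. lborel :: real measure" ..
  \<comment> \<open>The factors are reindexed by basis vectors; distinct \<open>i\<close> give
    distinct \<open>axis i 1\<close>, so the description picks the right index.\<close>
  define g where "g b = f (THE i. b = axis i (1::real))" for b :: "real^'n"
  have g: "g (axis i 1) = f i" for i by (simp add: g_def axis_eq_axis)
  have gi: "integrable lborel (g b)" for b by (simp add: g_def assms)
  have fm [measurable]: "f i \<in> borel_measurable borel" for i using assms[of i] by simp
  \<comment> \<open>Coordinates of the image of \<open>x\<close> under the map that carries the
    product measure to \<open>lborel\<close>.\<close>
  have c: "(\<Sum>b\<in>Basis. x b * b $ i) = x (axis i 1)" for x :: "real^'n \<Rightarrow> real" and i
  proof -
    have "(\<Sum>b\<in>Basis. x b *\<^sub>R b) \<bullet> axis i 1 = x (axis i 1)"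
      by (intro inner_sum_left_Basis) (auto simp: Basis_vec_def)
    then show ?thesis by (simp add: inner_axis)
  qed
  have "(\<integral>\<theta>. (\<Prod>i\<in>UNIV. f i (\<theta> $ i)) \<partial>(lborel :: (real^'n) measure)) =
      (\<integral>x. (\<Prod>i\<in>UNIV. f i (x (axis i 1))) \<partial>(\<Pi>\<^sub>M b\<in>(Basis::(real^'n) set). lborel))"
    by (subst lborel_eq, subst integral_distr) (simp_all add: c)
  also have "\<dots> = (\<integral>x. (\<Prod>b\<in>Basis. g b (x b)) \<partial>(\<Pi>\<^sub>M b\<in>(Basis::(real^'n) set). lborel))"
    by (simp add: prod_Basis_vec g)
  also have "\<dots> = (\<Prod>b\<in>Basis. \<integral>t. g b t \<partial>lborel)"
    by (rule product_integral_prod) (auto simp: gi)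
  also have "\<dots> = (\<Prod>i\<in>UNIV. \<integral>t. f i t \<partial>lborel)" by (simp add: prod_Basis_vec g)
  finally show ?thesis .
qed

section \<open>Laurent monomials on the torus\<close>

abbreviation torus_point :: "real ^ 'n \<Rightarrow> complex ^ 'n" where
  "torus_point \<theta> \<equiv> (\<chi> i. exp (\<i> * of_real (\<theta> $ i)))"

lemma laurent_monomial_torus:
  "laurent_monomial u (torus_point \<theta>) = (\<Prod>i\<in>UNIV. exp (\<i> * of_int (u $ i) * of_real (\<theta> $ i)))"
  by (simp add: laurent_monomial_def exp_power_int mult_ac)

text \<open>With the conjugation rule that follows, this merges two monomials and two conjugated
  ones into a single monomial.\<close>

lemma laurent_monomial_torus_add:
  "laurent_monomial (u + v) (torus_point \<theta>) = laurent_monomial u (torus_point \<theta>) * laurent_monomial v (torus_point \<theta>)"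
  by (simp add: laurent_monomial_torus distrib_left distrib_right exp_add prod.distrib)

lemma laurent_monomial_torus_uminus:
  "laurent_monomial (- u) (torus_point \<theta>) = cnj (laurent_monomial u (torus_point \<theta>))"
  by (simp add: laurent_monomial_torus exp_cnj)

lemma continuous_on_laurent_monomial_torus:
  "continuous_on S (\<lambda>\<theta>::real^'n. laurent_monomial u (torus_point \<theta>))"
  unfolding laurent_monomial_torus by (intro continuous_intros)

text \<open>The integral factors over the coordinates, and one nonzero exponent is enough to make a
  factor vanish.\<close>

lemma integral_laurent_monomial:
  "(LINT \<theta>:cbox 0 (\<chi> i. 2 * pi)|lborel. laurent_monomial u (torus_point \<theta>)) =
    (if u = 0 then (2 * pi) ^ CARD('n) else 0)" for u :: "int ^ 'n"
proof -
  let ?f = "\<lambda>i t. indicator {0..2*pi} t *\<^sub>R exp (\<i> * of_int (u $ i) * of_real t)"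
  \<comment> \<open>\<open>integral_prod_components\<close> integrates over the whole space, so the
    indicator of the box is split and absorbed into the factors.\<close>
  have ind: "indicator (cbox 0 (\<chi> i. 2 * pi)) \<theta> = (\<Prod>i\<in>UNIV. indicator {0..2*pi} (\<theta> $ i) :: real)"
    for \<theta> :: "real^'n"
    by (auto simp: indicator_def mem_box_cart prod_zero_iff)
  have "(LINT \<theta>:cbox 0 (\<chi> i. 2 * pi)|lborel. laurent_monomial u (torus_point \<theta>)) =
      (\<integral>\<theta>. (\<Prod>i\<in>UNIV. ?f i (\<theta> $ i)) \<partial>lborel)"
    unfolding set_lebesgue_integral_def laurent_monomial_torus ind
    by (simp add: scaleR_conv_of_real prod.distrib)
  also have "\<dots> = (\<Prod>i\<in>UNIV. \<integral>t. ?f i t \<partial>lborel)"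
    by (intro integral_prod_components borel_integrable_atLeastAtMost'[unfolded set_integrable_def] continuous_intros)
  also have "\<dots> = (\<Prod>i\<in>UNIV. if u $ i = 0 then complex_of_real (2 * pi) else 0)"
    by (intro prod.cong refl) (use integral_exp_int in \<open>simp add: set_lebesgue_integral_def\<close>)
  also have "\<dots> = (if u = 0 then (2 * pi) ^ CARD('n) else 0)"
    by (auto simp: vec_eq_iff prod_zero_iff)
  finally show ?thesis .
qed

section \<open>The fourth power of the norm as a sum over additive quadruples\<close>

text \<open>The integral is nonnegative, so the fourth power undoes the root; writing the fourth
  power of the modulus as \<open>z * z * cnj (z * z)\<close> makes the integrand expandable into
  monomials.\<close>

lemma torus_L4_norm_pow4:
  fixes f :: "complex ^ 'n \<Rightarrow> complex"
  shows "complex_of_real (torus_L4_norm f ^ 4) = 1 / (2 * pi) ^ CARD('n) *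
    (LINT \<theta>:cbox 0 (\<chi> i. 2 * pi)|lborel. f (torus_point \<theta>) * f (torus_point \<theta>) *
      cnj (f (torus_point \<theta>) * f (torus_point \<theta>)))"
proof -
  let ?I = "LINT \<theta>:cbox 0 (\<chi> i. 2 * pi)|lborel. cmod (f (torus_point \<theta>)) ^ 4"
  have "?I \<ge> 0" unfolding set_lebesgue_integral_def by (intro integral_nonneg_AE) simp
  then have "torus_L4_norm f ^ 4 = 1 / (2 * pi) ^ CARD('n) * ?I"
    unfolding torus_L4_norm_def by (intro real_root_pow_pos2) simp_all
  moreover have "of_real ?I = (LINT \<theta>:cbox 0 (\<chi> i. 2 * pi)|lborel. complex_of_real (cmod (f (torus_point \<theta>)) ^ 4))"
    unfolding set_lebesgue_integral_def by (simp flip: integral_complex_of_real add: scaleR_conv_of_real)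
  moreover have "complex_of_real (cmod z ^ 4) = z * z * cnj (z * z)" for z
  proof -
    have "complex_of_real (cmod z ^ 4) = complex_of_real ((cmod z)\<^sup>2) * complex_of_real ((cmod z)\<^sup>2)"
      by (simp flip: power_add)
    then show ?thesis by (simp only: complex_norm_square) (simp add: mult_ac)
  qed
  ultimately show ?thesis by simp
qed

text \<open>Only quadruples whose combined exponent \<open>a + b - (c + d)\<close> vanishes survive
  integration; each contributes \<open>(2 * pi) ^ CARD('n)\<close>, which cancels the
  normalization.\<close>

lemma torus_L4_norm_laurent_polynomial:
  fixes U :: "(int ^ 'n) set" and A :: "int ^ 'n \<Rightarrow> complex"
  assumes U: "finite U"
  shows "complex_of_real (torus_L4_norm (\<lambda>z. \<Sum>u\<in>U. A u * laurent_monomial u z) ^ 4) =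
    (\<Sum>(a, b, c, d) \<in> {(a, b, c, d). a \<in> U \<and> b \<in> U \<and> c \<in> U \<and> d \<in> U \<and> a + b = c + d}.
      A a * A b * cnj (A c * A d))"
proof -
  let ?C = "cbox 0 (\<chi> i. 2 * pi) :: (real^'n) set"
  let ?K = "complex_of_real ((2 * pi) ^ CARD('n))"
  let ?M = "\<lambda>u \<theta>. laurent_monomial u (torus_point \<theta> :: complex^'n)"
  let ?P = "\<lambda>\<theta>. \<Sum>u\<in>U. A u * ?M u \<theta>"
  let ?k = "\<lambda>(a, b, c, d). A a * A b * cnj (A c * A d)"
  \<comment> \<open>The exponent is written with \<open>+ -\<close> so that the rules for sums and
    negatives of exponents apply to it.\<close>
  have expand: "?P \<theta> * ?P \<theta> * cnj (?P \<theta> * ?P \<theta>) =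
      (\<Sum>(a, b, c, d)\<in>U \<times> U \<times> U \<times> U. ?k (a, b, c, d) * ?M ((a + b) + - (c + d)) \<theta>)" for \<theta>
    unfolding laurent_monomial_torus_add laurent_monomial_torus_uminus
    by (simp only: complex_cnj_mult cnj_sum sum_product4[symmetric])
      (simp add: sum.cartesian_product[symmetric] mult_ac)
  have int: "set_integrable lborel ?C (\<lambda>\<theta>. k * ?M u \<theta>)" for u k
    by (intro set_integrable_continuous_cbox continuous_intros continuous_on_laurent_monomial_torus)
  have "(LINT \<theta>:?C|lborel. ?P \<theta> * ?P \<theta> * cnj (?P \<theta> * ?P \<theta>)) =
      (\<Sum>(a, b, c, d)\<in>U \<times> U \<times> U \<times> U. LINT \<theta>:?C|lborel. ?k (a, b, c, d) * ?M ((a + b) + - (c + d)) \<theta>)"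
    unfolding expand case_prod_unfold
    using int unfolding set_lebesgue_integral_def set_integrable_def scaleR_sum_right
    by (intro Bochner_Integration.integral_sum) auto
  also have "\<dots> = (\<Sum>(a, b, c, d)\<in>U \<times> U \<times> U \<times> U. if a + b = c + d then ?k (a, b, c, d) * ?K else 0)"
    by (intro sum.cong) (auto simp: integral_laurent_monomial[unfolded of_real_power[symmetric]] eq_neg_iff_add_eq_0[symmetric])
  also have "\<dots> = (\<Sum>x\<in>{x \<in> U \<times> U \<times> U \<times> U. case x of (a, b, c, d) \<Rightarrow> a + b = c + d}. ?k x * ?K)"
    using U by (subst sum.inter_filter) (auto intro!: sum.cong)
  also have "{x \<in> U \<times> U \<times> U \<times> U. case x of (a, b, c, d) \<Rightarrow> a + b = c + d} =
      {(a, b, c, d). a \<in> U \<and> b \<in> U \<and> c \<in> U \<and> d \<in> U \<and> a + b = c + d}" by auto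
  finally have "(LINT \<theta>:?C|lborel. ?P \<theta> * ?P \<theta> * cnj (?P \<theta> * ?P \<theta>)) =
     (\<Sum>x\<in>{(a, b, c, d). a \<in> U \<and> b \<in> U \<and> c \<in> U \<and> d \<in> U \<and> a + b = c + d}. ?k x) * ?K"
    by (simp add: sum_distrib_right)
  then show ?thesis
    by (subst torus_L4_norm_pow4) auto
qed

section \<open>Combination of the fourth moment with Fourier inversion\<close>

theorem theorem7:
  fixes \<Gamma> :: "('a, 'b) monoid_scheme"
    and F :: "'a \<Rightarrow> complex"
    and \<pi> :: "int ^ 'n \<Rightarrow> 'a"
    and U :: "(int ^ 'n) set"
  assumes "comm_group \<Gamma>" and "finite (carrier \<Gamma>)"
    and "\<pi> \<in> hom int_lattice \<Gamma>"
    and "finite U"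
  shows "complex_of_real (torus_L4_norm (\<lambda>z. \<Sum>u\<in>U. F (\<pi> u) * laurent_monomial u z) ^ 4) =
    1 / of_nat (order \<Gamma>) ^ 5 *
    (\<Sum>(a, b, c, d) \<in> {(a, b, c, d). a \<in> U \<and> b \<in> U \<and> c \<in> U \<and> d \<in> U \<and> a + b = c + d}.
      \<Sum>\<kappa>\<in>carrier (char_group \<Gamma>). \<Sum>l\<in>carrier (char_group \<Gamma>).
      \<Sum>\<mu>\<in>carrier (char_group \<Gamma>). \<Sum>\<nu>\<in>carrier (char_group \<Gamma>).
        cnj ((\<kappa> \<circ> \<pi>) a * (l \<circ> \<pi>) b) * (\<mu> \<circ> \<pi>) c * (\<nu> \<circ> \<pi>) d * H_sum \<Gamma> F \<kappa> l \<mu> \<nu>)"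
proof -
  interpret \<Gamma>: finite_comm_group \<Gamma>
    using assms(1,2) by (simp add: finite_comm_group_def finite_comm_group_axioms_def)
  have \<pi>: "\<pi> u \<in> carrier \<Gamma>" "\<pi> (u + v) = \<pi> u \<otimes>\<^bsub>\<Gamma>\<^esub> \<pi> v" for u v
    using assms(3) by (auto simp: hom_def int_lattice_def Pi_def)
  \<comment> \<open>The homomorphism \<open>\<pi>\<close> carries \<open>a + b = c + d\<close> to
    the relation in \<open>\<Gamma>\<close> that \<open>sum_H_sum\<close> requires of the
    images.\<close>
  have "(\<Sum>\<kappa>\<in>carrier (char_group \<Gamma>). \<Sum>l\<in>carrier (char_group \<Gamma>).
      \<Sum>\<mu>\<in>carrier (char_group \<Gamma>). \<Sum>\<nu>\<in>carrier (char_group \<Gamma>).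
        cnj ((\<kappa> \<circ> \<pi>) a * (l \<circ> \<pi>) b) * (\<mu> \<circ> \<pi>) c * (\<nu> \<circ> \<pi>) d * H_sum \<Gamma> F \<kappa> l \<mu> \<nu>) =
      of_nat (order \<Gamma>) ^ 5 * (F (\<pi> a) * F (\<pi> b) * cnj (F (\<pi> c) * F (\<pi> d)))"
    if "a + b = c + d" for a b c d
    unfolding comp_def using \<pi> that by (intro \<Gamma>.sum_H_sum) metis+
  then have "(\<Sum>(a, b, c, d) \<in> {(a, b, c, d). a \<in> U \<and> b \<in> U \<and> c \<in> U \<and> d \<in> U \<and> a + b = c + d}.
      \<Sum>\<kappa>\<in>carrier (char_group \<Gamma>). \<Sum>l\<in>carrier (char_group \<Gamma>).
      \<Sum>\<mu>\<in>carrier (char_group \<Gamma>). \<Sum>\<nu>\<in>carrier (char_group \<Gamma>).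
        cnj ((\<kappa> \<circ> \<pi>) a * (l \<circ> \<pi>) b) * (\<mu> \<circ> \<pi>) c * (\<nu> \<circ> \<pi>) d * H_sum \<Gamma> F \<kappa> l \<mu> \<nu>) =
    (\<Sum>(a, b, c, d) \<in> {(a, b, c, d). a \<in> U \<and> b \<in> U \<and> c \<in> U \<and> d \<in> U \<and> a + b = c + d}.
      of_nat (order \<Gamma>) ^ 5 * (F (\<pi> a) * F (\<pi> b) * cnj (F (\<pi> c) * F (\<pi> d))))"
    by (intro sum.cong refl) (simp only: mem_Collect_eq split: prod.splits, blast)
  also have "\<dots> = of_nat (order \<Gamma>) ^ 5 *
      complex_of_real (torus_L4_norm (\<lambda>z. \<Sum>u\<in>U. F (\<pi> u) * laurent_monomial u z) ^ 4)"
    unfolding torus_L4_norm_laurent_polynomial[OF assms(4)] sum_distrib_left case_prod_unfold ..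
  \<comment> \<open>Positivity of the group order permits division by its fifth power.\<close>
  finally show ?thesis using \<Gamma>.order_pos by simp
qed

end
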